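(* Let $m\ge 1$ be an integer and $A\ge 0$ a real number, and let $P(q,t)=\frac1t\sum_{i=1}^{t}\Pr\{q_i(t)=q\}$ be the degree distribution at time $t$ of the DMS model with parameters $m$ and $A$. Then for every positive integer $q$ the steady-state degree distribution $P(q):=\lim_{t\to\infty}P(q,t)$ exists and is given by $$P(q)=\frac{m+A}{m}\,\frac{\Gamma\left(A+\frac{A}{m}+1\right)}{\Gamma(A)}\,\frac{\Gamma(q+A)}{\Gamma\left(q+A+2+\frac{A}{m}\right)}.$$ Moreover, for large $q$, $$P(q)\sim\frac{m+A}{m}\,\frac{\Gamma\left(A+\frac{A}{m}+1\right)}{\Gamma(A)}\,q^{-\left(2+\frac{A}{m}\right)},$$ that is, $$\lim_{q\to\infty}q^{2+\frac Am}P(q)=\frac{m+A}{m}\,\frac{\Gamma\left(A+\frac{A}{m}+1\right)}{\Gamma(A)}.$$ Here $1/\Gamma(A)$ is read as $0$ when $A=0$.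
   Context: DMS (general attractiveness) network model: vertices are labelled $i=1,2,3,\dots$, vertex $i$ being born at time $i$; $m$ is the number of new links injected at each step and $A$ is the initial attractiveness of a vertex. For each $i\ge 1$ the in-degree $(q_i(t))_{t=i,i+1,\dots}$ of vertex $i$ is a time-inhomogeneous Markov chain with values in $\{0,1,2,\dots\}$, with initial values $q_1(1)=m$ and $q_i(i)=0$ for $i\ge 2$ (almost surely), and with transition probabilities, for $t\ge i$ and $q$ in the range of $q_i(t)$ ($0\le q\le m(t-i)$ for $i\ge2$; $m\le q\le mt$ for $i=1$), $$\Pr\{q_i(t+1)=q+j\mid q_i(t)=q\}=\binom{m}{j}\left[\frac{q+A}{(m+A)t}\right]^{j}\left[1-\frac{q+A}{(m+A)t}\right]^{m-j},\qquad 0\le j\le m,$$ all other transitions having probability $0$ (convention $0^0=1$). The degree distribution of the network at time $t$ is $P(q,t)=\frac1t\sum_{i=1}^{t}P(q,i,t)$ where $P(q,i,t)=\Pr\{q_i(t)=q\}$. Only the marginal laws of the individual chains $q_i$ matter. *)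

theory Defs
  imports "HOL-Probability.Probability"
begin

(* Binomial(m, (q + A) / ((m + A) t)) weight of the jump from degree q at time t to degree q'
   at time t + 1.  On degrees that vertex i can actually have at time t the success
   probability lies in [0,1]; the formula is not used elsewhere. *)
definition dms_kernel :: "nat \<Rightarrow> real \<Rightarrow> nat \<Rightarrow> nat \<Rightarrow> nat \<Rightarrow> real" where
  "dms_kernel m A t q q' =
     (if q \<le> q' \<and> q' \<le> q + m
      then real (m choose (q' - q))
           * ((real q + A) / ((real m + A) * real t)) ^ (q' - q)
           * (1 - (real q + A) / ((real m + A) * real t)) ^ (m - (q' - q))
      else 0)"

(* X i t is the in-degree of vertex i at time t; only the indices 1 \<le> i \<le> t matter, and nothing
   is assumed about the joint law of the chains of different vertices.  Conditions on conditional
   probabilities are imposed only where the conditioning event has positive probability, since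
   cond_prob is 0 on null events.  This confines q in the transition law to the degrees that
   vertex i can have at time t. *)
locale dms_model = prob_space M
  for M :: "'w measure" and m :: nat and A :: real and X :: "nat \<Rightarrow> nat \<Rightarrow> 'w \<Rightarrow> nat" +
  assumes measurable_degree:
      "\<And>i t. 1 \<le> i \<Longrightarrow> i \<le> t \<Longrightarrow> X i t \<in> measurable M (count_space UNIV)"
    and initial_first: "AE \<omega> in M. X 1 1 \<omega> = m"
    and initial_later: "\<And>i. 2 \<le> i \<Longrightarrow> AE \<omega> in M. X i i \<omega> = 0"
    and markov:
      "\<And>i t h q'. 1 \<le> i \<Longrightarrow> i \<le> t \<Longrightarrow>
         \<P>(\<omega> in M. \<forall>s\<in>{i..t}. X i s \<omega> = h s) > 0 \<Longrightarrow>
         \<P>(\<omega> in M. X i (t + 1) \<omega> = q' \<bar> \<forall>s\<in>{i..t}. X i s \<omega> = h s)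
           = \<P>(\<omega> in M. X i (t + 1) \<omega> = q' \<bar> X i t \<omega> = h t)"
    and transition:
      "\<And>i t q q'. 1 \<le> i \<Longrightarrow> i \<le> t \<Longrightarrow>
         \<P>(\<omega> in M. X i t \<omega> = q) > 0 \<Longrightarrow>
         \<P>(\<omega> in M. X i (t + 1) \<omega> = q' \<bar> X i t \<omega> = q) = dms_kernel m A t q q'"

definition degree_distribution ::
    "'w measure \<Rightarrow> (nat \<Rightarrow> nat \<Rightarrow> 'w \<Rightarrow> nat) \<Rightarrow> nat \<Rightarrow> nat \<Rightarrow> real" where
  "degree_distribution M X q t = (\<Sum>i = 1..t. \<P>(\<omega> in M. X i t \<omega> = q)) / real t"

definition steady_state ::
    "'w measure \<Rightarrow> (nat \<Rightarrow> nat \<Rightarrow> 'w \<Rightarrow> nat) \<Rightarrow> nat \<Rightarrow> real" where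
  "steady_state M X q = lim (degree_distribution M X q)"

(* rGamma is the entire function 1 / Gamma, so rGamma 0 = 0. *)
definition dms_const :: "nat \<Rightarrow> real \<Rightarrow> real" where
  "dms_const m A = (real m + A) / real m * (Gamma (A + A / real m + 1) * rGamma A)"

end

theory Submission
  imports Defs
begin

text \<open>
  Only the one-step transition law enters. Summing it over the vertices, the expected number
  \<open>N t q\<close> of vertices of degree \<open>q\<close> satisfies
  \<open>N (t+1) q = (\<Sum>r\<le>q. N t r * K t r q) + [q = 0]\<close>, where the kernel obeys
  \<open>t * (1 - K t q q) \<longlonglongrightarrow> m * a q\<close>, \<open>t * K t r q \<longlonglongrightarrow> m * a r\<close> for \<open>r = q - 1\<close> and \<open>\<longlonglongrightarrow> 0\<close> for
  \<open>r < q - 1\<close>, with \<open>a q = (q + A) / (m + A)\<close>. By strong induction on \<open>q\<close>, \<open>N t q / t\<close> converges to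
  the solution of \<open>P q * (1 + m * a q) = P (q - 1) * m * a (q - 1) + [q = 0]\<close>, which is the stated
  quotient of Gamma functions. Its asymptotics follow from Euler's limit for Gamma.
\<close>

section \<open>Linear recurrences with a coefficient of order 1/t\<close>

text \<open>With \<open>L = c / (1 + b)\<close>, the error \<open>x t - L * t\<close> obeys the same recursion with an
  inhomogeneity tending to 0, so it grows sublinearly.\<close>

lemma linear_recurrence_slope:
  fixes x b c :: "nat \<Rightarrow> real"
  assumes rec: "eventually (\<lambda>t. x (Suc t) = (1 - b t) * x t + c t) sequentially"
    and b01: "eventually (\<lambda>t. 0 \<le> b t \<and> b t \<le> 1) sequentially"
    and b: "(\<lambda>t. real t * b t) \<longlonglongrightarrow> \<beta>"
    and c: "c \<longlonglongrightarrow> \<gamma>"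
    and \<beta>: "1 + \<beta> \<noteq> 0"
  shows "(\<lambda>t. x t / real t) \<longlonglongrightarrow> \<gamma> / (1 + \<beta>)"
proof -
  define L where "L = \<gamma> / (1 + \<beta>)"
  define y where "y = (\<lambda>t. x t - L * real t)"
  define e where "e = (\<lambda>t. c t - L - L * (real t * b t))"
  have "e \<longlonglongrightarrow> \<gamma> - L - L * \<beta>"
    unfolding e_def by (intro tendsto_intros b c)
  moreover have "\<gamma> - L - L * \<beta> = 0"
    using \<beta> by (simp add: L_def field_simps)
  ultimately have e0: "e \<longlonglongrightarrow> 0" by simp
  have "(\<lambda>t. y t / real t) \<longlonglongrightarrow> 0"
  proof (rule LIMSEQ_I)
    fix r :: real assume "r > 0"
    have "eventually (\<lambda>t. \<bar>e t\<bar> < r / 2) sequentially"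
      using order_tendstoD(2)[OF tendsto_rabs_zero[OF e0], of "r / 2"] \<open>r > 0\<close> by simp
    with rec b01 have "eventually (\<lambda>t. x (Suc t) = (1 - b t) * x t + c t
        \<and> 0 \<le> b t \<and> b t \<le> 1 \<and> \<bar>e t\<bar> < r / 2) sequentially"
      by eventually_elim simp
    then obtain T where T: "x (Suc t) = (1 - b t) * x t + c t"
        "0 \<le> b t" "b t \<le> 1" "\<bar>e t\<bar> < r / 2" if "t \<ge> T" for t
      unfolding eventually_sequentially by blast
    have step: "\<bar>y (Suc t)\<bar> \<le> \<bar>y t\<bar> + r / 2" if "t \<ge> T" for t
    proof -
      have "y (Suc t) = (1 - b t) * y t + e t"
        using T(1)[OF that] by (simp add: y_def e_def algebra_simps)
      then have "\<bar>y (Suc t)\<bar> \<le> (1 - b t) * \<bar>y t\<bar> + \<bar>e t\<bar>"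
        using T(2,3)[OF that] abs_triangle_ineq[of "(1 - b t) * y t" "e t"] by (simp add: abs_mult)
      also have "\<dots> \<le> 1 * \<bar>y t\<bar> + r / 2"
        using T(2-4)[OF that] by (intro add_mono mult_right_mono) auto
      finally show ?thesis by simp
    qed
    have bound: "\<bar>y t\<bar> \<le> \<bar>y T\<bar> + r / 2 * real t" if "t \<ge> T" for t
      using that
    proof (induction t rule: dec_induct)
      case base
      then show ?case using \<open>r > 0\<close> by simp
    next
      case (step t)
      then show ?case using \<open>\<And>t. t \<ge> T \<Longrightarrow> \<bar>y (Suc t)\<bar> \<le> \<bar>y t\<bar> + r / 2\<close>[of t]
        by (simp add: field_simps)
    qed
    \<comment> \<open>From \<open>n0\<close> on, the offset \<open>\<bar>y T\<bar>\<close> costs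
      less than \<open>r / 2 * n\<close>; the accumulated errors cost at most the other
      half.\<close>
    obtain n0 where n0: "\<bar>y T\<bar> < real n0 * (r / 2)"
      using reals_Archimedean3[of "r / 2"] \<open>r > 0\<close> by auto
    show "\<exists>no. \<forall>n\<ge>no. norm (y n / real n - 0) < r"
    proof (intro exI allI impI)
      fix n assume n: "n \<ge> max (max T n0) 1"
      have "real n0 * (r / 2) \<le> real n * (r / 2)"
        using n \<open>r > 0\<close> by (intro mult_right_mono) auto
      with bound[of n] n n0 have "\<bar>y n\<bar> < r * real n"
        by (simp add: algebra_simps)
      then show "norm (y n / real n - 0) < r"
        using n by (simp add: divide_less_eq)
    qed
  qed
  then have "(\<lambda>t. L + y t / real t) \<longlonglongrightarrow> L + 0"
    by (intro tendsto_intros)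
  moreover have "eventually (\<lambda>t. L + y t / real t = x t / real t) sequentially"
    using eventually_gt_at_top[of 0] by eventually_elim (simp add: y_def field_simps)
  ultimately have "(\<lambda>t. x t / real t) \<longlonglongrightarrow> L + 0"
    by (rule Lim_transform_eventually)
  then show ?thesis by (simp add: L_def)
qed

section \<open>Large-time limits of the transition kernel\<close>

lemma tendsto_one_minus_divide_power:
  fixes a :: real
  shows "(\<lambda>t. (1 - a / real t) ^ n) \<longlonglongrightarrow> 1"
proof -
  have "(\<lambda>t. (1 - a / real t) ^ n) \<longlonglongrightarrow> (1 - 0) ^ n"
    by (intro tendsto_intros lim_const_over_n)
  then show ?thesis by simp
qed

text \<open>Raising the exponent by one adds exactly \<open>a * (1 - a / real t) ^ n\<close>, which
  tends to \<open>a\<close>; induction on \<open>n\<close> therefore avoids derivatives.\<close>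

lemma tendsto_times_one_minus_power:
  fixes a :: real
  shows "(\<lambda>t. real t * (1 - (1 - a / real t) ^ n)) \<longlonglongrightarrow> real n * a"
proof (induction n)
  case 0
  then show ?case by simp
next
  case (Suc n)
  have "(\<lambda>t. real t * (1 - (1 - a / real t) ^ n) + a * (1 - a / real t) ^ n) \<longlonglongrightarrow> real n * a + a * 1"
    by (intro tendsto_intros Suc tendsto_one_minus_divide_power)
  moreover have "eventually (\<lambda>t. real t * (1 - (1 - a / real t) ^ n) + a * (1 - a / real t) ^ n
      = real t * (1 - (1 - a / real t) ^ Suc n)) sequentially"
    using eventually_gt_at_top[of 0] by eventually_elim (simp add: field_simps)
  ultimately have "(\<lambda>t. real t * (1 - (1 - a / real t) ^ Suc n)) \<longlonglongrightarrow> real n * a + a * 1"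
    by (rule Lim_transform_eventually)
  then show ?case by (simp add: algebra_simps)
qed

lemma dms_kernel_self:
  "dms_kernel m A t q q = (1 - (real q + A) / (real m + A) / real t) ^ m"
  by (simp add: dms_kernel_def)

text \<open>A jump of size \<open>q - r\<close> carries that many factors of order 1/t.
  Multiplication by \<open>t\<close> absorbs one of them, so only jumps of size 1 survive in the
  limit.\<close>

lemma dms_kernel_lower_limit:
  assumes "m \<ge> 1" "r < q"
  shows "(\<lambda>t. real t * dms_kernel m A t r q)
    \<longlonglongrightarrow> (if q = Suc r then real m * ((real r + A) / (real m + A)) else 0)"
proof (cases "q \<le> r + m")
  case False
  then show ?thesis using assms by (auto simp: dms_kernel_def)
next
  case True
  define a where "a = (real r + A) / (real m + A)"
  define j where "j = q - r - 1"
  have j: "q - r = Suc j" using assms by (simp add: j_def)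
  have "(\<lambda>t. real (m choose Suc j) * a * (a / real t) ^ j * (1 - a / real t) ^ (m - Suc j))
     \<longlonglongrightarrow> real (m choose Suc j) * a * 0 ^ j * 1"
    by (intro tendsto_intros tendsto_one_minus_divide_power lim_const_over_n)
  also have "real (m choose Suc j) * a * 0 ^ j * 1 =
      (if q = Suc r then real m * ((real r + A) / (real m + A)) else 0)"
    using assms by (auto simp: j_def a_def power_0_left)
  finally show ?thesis
  proof (rule Lim_transform_eventually)
    show "eventually (\<lambda>t. real (m choose Suc j) * a * (a / real t) ^ j
      * (1 - a / real t) ^ (m - Suc j) = real t * dms_kernel m A t r q) sequentially"
    using eventually_gt_at_top[of 0]
      by eventually_elim (use True assms in \<open>simp add: dms_kernel_def j flip: a_def divide_divide_eq_left\<close>)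
  qed
qed

section \<open>Expected degree counts and their growth rate\<close>

context dms_model
begin

lemma total_probability:
  assumes "1 \<le> i" "i \<le> t"
  shows "\<P>(\<omega> in M. X i (Suc t) \<omega> = q) =
    (\<Sum>r\<le>q. \<P>(\<omega> in M. X i t \<omega> = r) * dms_kernel m A t r q)"
proof -
  have meas [measurable]: "X i t \<in> measurable M (count_space UNIV)"
      "X i (Suc t) \<in> measurable M (count_space UNIV)"
    using assms by (auto intro!: measurable_degree)
  have joint: "\<P>(\<omega> in M. X i (Suc t) \<omega> = q \<and> X i t \<omega> = r)
      = \<P>(\<omega> in M. X i t \<omega> = r) * dms_kernel m A t r q" for r
  proof (cases "\<P>(\<omega> in M. X i t \<omega> = r) > 0")
    case True
    with transition[OF assms True, of q] show ?thesis
      by (simp add: cond_prob_def field_simps)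
  next
    \<comment> \<open>The transition law says nothing on a null conditioning event, but there both
      sides are 0.\<close>
    case False
    then have 0: "\<P>(\<omega> in M. X i t \<omega> = r) = 0"
      using measure_nonneg[of M "{\<omega> \<in> space M. X i t \<omega> = r}"] by linarith
    have "\<P>(\<omega> in M. X i (Suc t) \<omega> = q \<and> X i t \<omega> = r) \<le> \<P>(\<omega> in M. X i t \<omega> = r)"
      by (intro finite_measure_mono) auto
    with 0 have "\<P>(\<omega> in M. X i (Suc t) \<omega> = q \<and> X i t \<omega> = r) = 0"
      by (metis measure_nonneg order_antisym)
    with 0 show ?thesis by simp
  qed
  \<comment> \<open>Degrees never decrease: the kernel vanishes for \<open>r > q\<close>. Discarding
    these countably many null events leaves a finite disjoint union.\<close>
  have "AE \<omega> in M. \<not> (X i (Suc t) \<omega> = q \<and> X i t \<omega> = r)" if "r > q" for r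
  proof -
    have "\<P>(\<omega> in M. X i (Suc t) \<omega> = q \<and> X i t \<omega> = r) = 0"
      using joint[of r] that by (simp add: dms_kernel_def)
    then show ?thesis by (subst (asm) prob_Collect_eq_0) simp_all
  qed
  then have "AE \<omega> in M. \<forall>r\<in>{q<..}. \<not> (X i (Suc t) \<omega> = q \<and> X i t \<omega> = r)"
    by (subst AE_ball_countable) auto
  then have "AE \<omega> in M. X i (Suc t) \<omega> = q \<longleftrightarrow> (\<exists>r\<in>{..q}. X i (Suc t) \<omega> = q \<and> X i t \<omega> = r)"
    by eventually_elim (use not_le in blast)
  then have "\<P>(\<omega> in M. X i (Suc t) \<omega> = q)
      = \<P>(\<omega> in M. \<exists>r\<in>{..q}. X i (Suc t) \<omega> = q \<and> X i t \<omega> = r)"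
    by (intro measure_eq_AE) auto
  also have "{\<omega> \<in> space M. \<exists>r\<in>{..q}. X i (Suc t) \<omega> = q \<and> X i t \<omega> = r}
      = (\<Union>r\<in>{..q}. {\<omega> \<in> space M. X i (Suc t) \<omega> = q \<and> X i t \<omega> = r})"
    by blast
  also have "prob \<dots> = (\<Sum>r\<le>q. \<P>(\<omega> in M. X i (Suc t) \<omega> = q \<and> X i t \<omega> = r))"
    by (intro finite_measure_finite_Union) (auto simp: disjoint_family_on_def)
  finally show ?thesis by (simp add: joint)
qed

lemma prob_newborn:
  assumes "i \<ge> 2"
  shows "\<P>(\<omega> in M. X i i \<omega> = q) = of_bool (q = 0)"
proof -
  have [measurable]: "X i i \<in> measurable M (count_space UNIV)"
    using assms by (intro measurable_degree) auto
  show ?thesis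
  proof (cases "q = 0")
    case True
    then show ?thesis using initial_later[OF assms] by (simp add: prob_Collect_eq_1)
  next
    case False
    then have "AE \<omega> in M. \<not> X i i \<omega> = q"
      using initial_later[OF assms] by auto
    with False show ?thesis by (simp add: prob_Collect_eq_0)
  qed
qed

text \<open>The degree distribution without the factor 1/t, so that its recursion in
  \<open>t\<close> needs no renormalisation.\<close>

definition expected_count :: "nat \<Rightarrow> nat \<Rightarrow> real" where
  "expected_count t q = (\<Sum>i = 1..t. \<P>(\<omega> in M. X i t \<omega> = q))"

text \<open>The kernel is the same for all vertices, so the one-step law can be summed over them.
  Since \<open>t \<ge> 1\<close>, the newborn vertex has index at least 2 and starts with degree
  0.\<close>

lemma expected_count_Suc:
  assumes "t \<ge> 1"
  shows "expected_count (Suc t) q =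
    (\<Sum>r\<le>q. expected_count t r * dms_kernel m A t r q) + of_bool (q = 0)"
proof -
  have "expected_count (Suc t) q =
      (\<Sum>i = 1..t. \<P>(\<omega> in M. X i (Suc t) \<omega> = q)) + \<P>(\<omega> in M. X (Suc t) (Suc t) \<omega> = q)"
    by (simp add: expected_count_def)
  also have "(\<Sum>i = 1..t. \<P>(\<omega> in M. X i (Suc t) \<omega> = q)) =
      (\<Sum>i = 1..t. \<Sum>r\<le>q. \<P>(\<omega> in M. X i t \<omega> = r) * dms_kernel m A t r q)"
    by (intro sum.cong total_probability) auto
  also have "\<dots> = (\<Sum>r\<le>q. expected_count t r * dms_kernel m A t r q)"
    by (subst sum.swap) (simp add: expected_count_def sum_distrib_right)
  also have "\<P>(\<omega> in M. X (Suc t) (Suc t) \<omega> = q) = of_bool (q = 0)"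
    using assms by (intro prob_newborn) auto
  finally show ?thesis .
qed

text \<open>The two equations for \<open>P\<close> say that the slopes produced by
  \<open>linear_recurrence_slope\<close> are consistent; they determine \<open>P\<close>
  recursively, and any solution is the limit.\<close>

lemma degree_distribution_limit:
  fixes P :: "nat \<Rightarrow> real"
  assumes "m \<ge> 1" "A \<ge> 0"
    and P0: "P 0 * (1 + real m * (A / (real m + A))) = 1"
    and PSuc: "\<And>q. P (Suc q) * (1 + real m * ((real (Suc q) + A) / (real m + A)))
      = P q * (real m * ((real q + A) / (real m + A)))"
  shows "degree_distribution M X q \<longlonglongrightarrow> P q"
proof (induction q rule: less_induct)
  case (less q)
  have dd: "degree_distribution M X r = (\<lambda>t. expected_count t r / real t)" for r
    by (simp add: fun_eq_iff degree_distribution_def expected_count_def)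
  define a where "a = (real q + A) / (real m + A)"
  have a: "a \<ge> 0" using assms by (simp add: a_def)
  \<comment> \<open>The inflow from lower degrees, with \<open>t\<close> inserted so that both
    factors converge: the first by induction, the second by the kernel limit.\<close>
  define c where "c = (\<lambda>t. (\<Sum>r<q. expected_count t r / real t * (real t * dms_kernel m A t r q))
    + of_bool (q = 0))"
  define \<gamma> where "\<gamma> = (\<Sum>r<q. P r * (if q = Suc r then real m * ((real r + A) / (real m + A)) else 0))
    + of_bool (q = 0)"
  have "(\<lambda>t. expected_count t q / real t) \<longlonglongrightarrow> \<gamma> / (1 + real m * a)"
  proof (rule linear_recurrence_slope[where b = "\<lambda>t. 1 - (1 - a / real t) ^ m" and c = c])
    show "eventually (\<lambda>t. expected_count (Suc t) q =
        (1 - (1 - (1 - a / real t) ^ m)) * expected_count t q + c t) sequentially"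
      using eventually_ge_at_top[of 1]
    proof eventually_elim
      case (elim t)
      have "(\<Sum>r\<le>q. expected_count t r * dms_kernel m A t r q) =
          (\<Sum>r<q. expected_count t r * dms_kernel m A t r q)
          + expected_count t q * (1 - a / real t) ^ m"
        by (simp add: a_def dms_kernel_self flip: lessThan_Suc_atMost)
      with elim show ?case
        by (simp add: expected_count_Suc c_def)
    qed
    \<comment> \<open>The base \<open>1 - a / real t\<close> may be negative for small
      \<open>t\<close>; once it lies in [0,1], so does its power.\<close>
    have "eventually (\<lambda>t. a / real t < 1) sequentially"
      by (rule order_tendstoD[OF lim_const_over_n]) simp
    then show "eventually (\<lambda>t. 0 \<le> 1 - (1 - a / real t) ^ m \<and> 1 - (1 - a / real t) ^ m \<le> 1)
        sequentially"
      by eventually_elim (use a in \<open>auto intro!: power_le_one\<close>)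
    show "(\<lambda>t. real t * (1 - (1 - a / real t) ^ m)) \<longlonglongrightarrow> real m * a"
      by (rule tendsto_times_one_minus_power)
    show "c \<longlonglongrightarrow> \<gamma>"
      unfolding c_def \<gamma>_def
      by (intro tendsto_intros dms_kernel_lower_limit less[unfolded dd]) (use assms in auto)
    show "1 + real m * a \<noteq> 0"
      using a by (simp add: add_nonneg_eq_0_iff)
  qed
  moreover have "\<gamma> / (1 + real m * a) = P q"
  proof -
    have pos: "1 + real m * a > 0" using a by (simp add: add_pos_nonneg)
    have "\<gamma> = P q * (1 + real m * a)"
    proof (cases q)
      case 0
      then show ?thesis using P0 by (simp add: \<gamma>_def a_def)
    next
      case (Suc k)
      have "(\<Sum>r<k. P r * (if q = Suc r then real m * ((real r + A) / (real m + A)) else 0)) = 0"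
        by (intro sum.neutral) (use Suc in auto)
      then show ?thesis using PSuc[of k] Suc by (simp add: \<gamma>_def a_def)
    qed
    then show ?thesis using pos by simp
  qed
  ultimately show ?case by (simp add: dd)
qed

end

section \<open>Asymptotics of a quotient of Gamma functions\<close>

lemma Gamma_quotient_tendsto:
  fixes A B :: real
  assumes "A > 0" "B \<ge> 0"
  shows "(\<lambda>q. real q powr (2 + B) * (Gamma (real q + A) / Gamma (real q + A + 2 + B))) \<longlonglongrightarrow> 1"
proof -
  \<comment> \<open>For \<open>z > 0\<close> this is eventually
    \<open>Gamma_series z q / Gamma z\<close>, with the Pochhammer symbol written as a Gamma
    quotient.\<close>
  define G where "G = (\<lambda>z q. fact q * real q powr z / Gamma (z + real q + 1))"
  have G: "G z \<longlonglongrightarrow> 1" if z: "z > 0" for z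
  proof -
    have nz: "z \<notin> \<int>\<^sub>\<le>\<^sub>0" using z by (auto elim!: nonpos_Ints_cases)
    have Gz: "Gamma z > 0" using z by (rule Gamma_real_pos)
    have "(\<lambda>q. Gamma_series z q / Gamma z) \<longlonglongrightarrow> Gamma z / Gamma z"
      using Gz by (intro tendsto_intros Gamma_series_LIMSEQ) auto
    moreover have "eventually (\<lambda>q. Gamma_series z q / Gamma z = G z q) sequentially"
      using eventually_gt_at_top[of 0]
      by eventually_elim
        (use Gz nz in \<open>simp add: Gamma_series_def G_def pochhammer_Gamma powr_def add_ac mult_ac\<close>)
    ultimately have "G z \<longlonglongrightarrow> Gamma z / Gamma z" by (rule Lim_transform_eventually)
    then show ?thesis using Gz by simp
  qed
  \<comment> \<open>The quotient of the two \<open>G\<close> terms yields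
    \<open>Gamma (q + A + 1)\<close> in the numerator; the last factor \<open>q / (q + A)\<close>
    turns it into \<open>q * Gamma (q + A)\<close>. Obtaining \<open>Gamma (q + A)\<close> directly
    would take \<open>G\<close> at \<open>A - 1\<close>, which may be negative.\<close>
  have "(\<lambda>q. G (A + 1 + B) q / G A q * (1 - A / (real q + A))) \<longlonglongrightarrow> 1 / 1 * (1 - 0)"
    by (intro tendsto_intros G)
       (use assms in \<open>auto intro!: real_tendsto_divide_at_top[OF tendsto_const]
          filterlim_at_top_add_at_top filterlim_real_sequentially
          filterlim_tendsto_add_at_top[OF tendsto_const] simp: add.commute[of _ A]\<close>)
  moreover have "eventually (\<lambda>q. G (A + 1 + B) q / G A q * (1 - A / (real q + A)) =
      real q powr (2 + B) * (Gamma (real q + A) / Gamma (real q + A + 2 + B))) sequentially"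
    using eventually_gt_at_top[of 0]
  proof eventually_elim
    case (elim q)
    have "Gamma (A + real q + 1) = (A + real q) * Gamma (A + real q)"
      using assms elim by (intro Gamma_plus1) (auto elim!: nonpos_Ints_cases)
    then have "G A q = fact q * real q powr A / ((A + real q) * Gamma (A + real q))"
      by (simp add: G_def)
    moreover have "G (A + 1 + B) q = fact q * (real q powr A * real q powr (1 + B))
        / Gamma (real q + A + 2 + B)"
      by (simp add: G_def add_ac flip: powr_add)
    moreover have "1 - A / (real q + A) = real q / (A + real q)"
      using elim assms by (simp add: field_simps)
    \<comment> \<open>The field identity behind the step, with Gamma values and powers abstracted.
      If \<open>g\<close> or \<open>h\<close> is 0, both sides are 0 because
      \<open>x / 0 = 0\<close>.\<close>
    moreover have "(f * (u * v) / h) / (f * u / (s * g)) * (x / s) = x * v * (g / h)"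
      if "f > 0" "u > 0" "s > 0" for f u v h s g x :: real
      using that by (cases "g = 0"; cases "h = 0") (simp_all add: field_simps)
    moreover have "real q powr (2 + B) = real q * real q powr (1 + B)"
    proof -
      have "real q powr (1 + (1 + B)) = real q powr 1 * real q powr (1 + B)"
        by (rule powr_add)
      then show ?thesis using elim by simp
    qed
    ultimately show ?case
      using elim assms by (simp add: add.commute[of _ A])
  qed
  ultimately have "(\<lambda>q. real q powr (2 + B) * (Gamma (real q + A) / Gamma (real q + A + 2 + B)))
      \<longlonglongrightarrow> 1 / 1 * (1 - 0)"
    by (rule Lim_transform_eventually)
  then show ?thesis by simp
qed

section \<open>Closed form of the limit and its power law\<close>

theorem theorem2p1:
  fixes M :: "'w measure" and X :: "nat \<Rightarrow> nat \<Rightarrow> 'w \<Rightarrow> nat" and m :: nat and A :: real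
  assumes "m \<ge> 1" and "A \<ge> 0" and "dms_model M m A X"
  shows "(\<forall>q\<ge>1. convergent (degree_distribution M X q) \<and>
            steady_state M X q =
              dms_const m A * (Gamma (real q + A) / Gamma (real q + A + 2 + A / real m))) \<and>
         steady_state M X \<sim>[at_top]
           (\<lambda>q. dms_const m A * real q powr (- (2 + A / real m))) \<and>
         (\<lambda>q. real q powr (2 + A / real m) * steady_state M X q) \<longlonglongrightarrow> dms_const m A"
proof -
  interpret dms_model M m A X by fact
  define B where "B = A / real m"
  have B: "B \<ge> 0" using assms by (simp add: B_def)
  have AB: "real m * B = A" using assms by (simp add: B_def)
  \<comment> \<open>\<open>pochhammer A q\<close> is \<open>Gamma (q + A) / Gamma A\<close>, but is also correct for \<open>A = 0\<close>, \<open>q = 0\<close>,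
    where \<open>Gamma (q + A)\<close> has a pole.\<close>
  define P where "P = (\<lambda>q. (real m + A) / real m * Gamma (A + B + 1) * pochhammer A q
    / Gamma (real q + A + 2 + B))"
  have Gp: "Gamma (real q + A + 2 + B) > 0" for q
    using assms B by (intro Gamma_real_pos) auto
  have "Gamma (A + B + 1 + 1) = (A + B + 1) * Gamma (A + B + 1)"
    using assms B by (intro Gamma_plus1) (auto elim!: nonpos_Ints_cases)
  moreover have "Gamma (A + B + 1) > 0" using assms B by (intro Gamma_real_pos) auto
  ultimately have P0': "P 0 = (real m + A) / real m / (A + B + 1)"
    by (simp add: P_def add_ac)
  have mA: "real m > 0" "real m + A > 0" "A + B + 1 > 0" using assms B by auto
  have P0: "P 0 * (1 + real m * (A / (real m + A))) = 1"
  proof -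
    have "1 + real m * (A / (real m + A)) = real m * (A + B + 1) / (real m + A)"
      using mA AB by (simp add: field_simps)
    then show ?thesis using mA by (simp add: P0')
  qed
  have PSuc: "P (Suc q) * (1 + real m * ((real (Suc q) + A) / (real m + A)))
      = P q * (real m * ((real q + A) / (real m + A)))" for q
  proof -
    \<comment> \<open>The outflow factor at degree \<open>q + 1\<close> is
      \<open>m * z / (m + A)\<close>, and its \<open>z\<close> cancels the one from
      \<open>Gamma (z + 1) = z * Gamma z\<close>. This is the origin of the shift
      \<open>2 + A / m\<close>.\<close>
    define z where "z = real q + A + 2 + B"
    have z: "z > 0" "Gamma z > 0" using assms B Gp by (auto simp: z_def)
    have "Gamma (z + 1) = z * Gamma z"
      using z by (intro Gamma_plus1) (auto elim!: nonpos_Ints_cases)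
    moreover have "real (Suc q) + A + 2 + B = z + 1" by (simp add: z_def)
    moreover have "1 + real m * ((real (Suc q) + A) / (real m + A)) = real m * z / (real m + A)"
      using mA AB by (simp add: z_def field_simps)
    ultimately have "P (Suc q) * (1 + real m * ((real (Suc q) + A) / (real m + A))) =
       (real m + A) / real m * Gamma (A + B + 1) * (pochhammer A q * (A + real q)) / (z * Gamma z)
         * (real m * z / (real m + A))"
      by (simp only: P_def pochhammer_Suc)
    also have "\<dots> = P q * (real m * ((real q + A) / (real m + A)))"
    proof -
      have "n / k * g * (p * s) / (z * h) * (k * z / n) = n / k * g * p / h * (k * (s / n))"
        if "n > 0" "k > 0" "z > 0" "h > 0" for n k g p s z h :: real
        using that by (simp add: divide_simps)
      from this[OF mA(2,1) z] show ?thesis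
        unfolding P_def z_def[symmetric] by (simp only: add.commute[of "real q" A])
    qed
    finally show ?thesis .
  qed
  have lim: "degree_distribution M X q \<longlonglongrightarrow> P q" for q
    using assms P0 PSuc by (intro degree_distribution_limit) auto
  have ss: "steady_state M X q = P q" for q
    unfolding steady_state_def by (rule limI[OF lim])
  \<comment> \<open>At \<open>A = 0\<close> both sides vanish for \<open>q \<ge> 1\<close>, whereas
    \<open>P 0 = 1\<close> and the right-hand side at \<open>q = 0\<close> is 0.\<close>
  have P: "P q = dms_const m A * (Gamma (real q + A) / Gamma (real q + A + 2 + B))" if "q \<ge> 1" for q
  proof (cases "A = 0")
    case True
    then show ?thesis using that by (simp add: P_def dms_const_def pochhammer_0_left)
  next
    case False
    then have "A \<notin> \<int>\<^sub>\<le>\<^sub>0" using assms by (auto elim!: nonpos_Ints_cases)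
    then show ?thesis
      by (simp add: P_def dms_const_def pochhammer_Gamma rGamma_inverse_Gamma B_def
          divide_inverse add_ac mult_ac)
  qed
  \<comment> \<open>For \<open>A \<ge> 0\<close> the only pole of Gamma is at 0, and the other
    factors of the constant are positive.\<close>
  have c0: "dms_const m A = 0 \<longleftrightarrow> A = 0"
    using assms mA less_imp_neq[OF Gamma_real_pos[OF mA(3)], symmetric]
    by (auto simp: dms_const_def rGamma_eq_zero_iff simp flip: B_def elim!: nonpos_Ints_cases)
  have limit: "(\<lambda>q. real q powr (2 + B) * P q) \<longlonglongrightarrow> dms_const m A"
  proof -
    have "(\<lambda>q. dms_const m A * (real q powr (2 + B)
        * (Gamma (real q + A) / Gamma (real q + A + 2 + B)))) \<longlonglongrightarrow> dms_const m A"
    proof (cases "A = 0")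
      case True
      then show ?thesis using c0 by simp
    next
      case False
      then have "A > 0" using assms by simp
      from tendsto_mult_left[OF Gamma_quotient_tendsto[OF this B], of "dms_const m A"]
      show ?thesis by simp
    qed
    moreover have "eventually (\<lambda>q. dms_const m A * (real q powr (2 + B)
        * (Gamma (real q + A) / Gamma (real q + A + 2 + B))) = real q powr (2 + B) * P q) sequentially"
      using eventually_ge_at_top[of 1] by eventually_elim (simp add: P)
    ultimately show ?thesis by (rule Lim_transform_eventually)
  qed
  \<comment> \<open>Dividing by the constant requires \<open>A > 0\<close>. For \<open>A = 0\<close>
    both functions are eventually 0, and equivalence holds by eventual equality.\<close>
  have "P \<sim>[at_top] (\<lambda>q. dms_const m A * real q powr (- (2 + B)))"
  proof (cases "A = 0")
    case True
    have "eventually (\<lambda>q. P q = dms_const m A * real q powr (- (2 + B))) sequentially"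
      using eventually_ge_at_top[of 1] by eventually_elim (use True c0 in \<open>simp add: P\<close>)
    then show ?thesis by (rule asymp_equiv_refl_ev)
  next
    case False
    with c0 have c: "dms_const m A \<noteq> 0" by simp
    have "(\<lambda>q. real q powr (2 + B) * P q / dms_const m A) \<longlonglongrightarrow> dms_const m A / dms_const m A"
      by (intro tendsto_intros limit c)
    moreover have "eventually (\<lambda>q. real q powr (2 + B) * P q / dms_const m A
        = P q / (dms_const m A * real q powr (- (2 + B)))) sequentially"
      using eventually_gt_at_top[of 0]
      by eventually_elim (simp add: powr_minus field_simps del: minus_add_distrib)
    ultimately have "(\<lambda>q. P q / (dms_const m A * real q powr (- (2 + B))))
        \<longlonglongrightarrow> dms_const m A / dms_const m A"
      by (rule Lim_transform_eventually)
    then show ?thesis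
      using c by (intro asymp_equivI') simp
  qed
  moreover have "steady_state M X = P" using ss by blast
  ultimately show ?thesis
    using lim limit P unfolding B_def by (auto simp: convergent_def)
qed

end
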